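(* Let $A,B\in M_n(\mathbb{C})$ be positive definite. If $v,\tau$ and $\lambda$ are real numbers with $0<v\le\tau<1$ and $\lambda\ge 1$, then $$\left(\frac{v}{\tau}\right)^{\lambda}\det\left(A\nabla_\tau B-A!_\tau B\right)^{\frac{\lambda}{n}}\le\det\left(A\nabla_v B\right)^{\frac{\lambda}{n}}-\det\left(A!_v B\right)^{\frac{\lambda}{n}}.$$
   Context: $M_n(\mathbb{C})$ is the space of $n\times n$ complex matrices. For positive definite $A,B\in M_n(\mathbb{C})$ and $0\le v\le 1$, the weighted arithmetic and harmonic means are $A\nabla_v B=vA+(1-v)B$ and $A!_v B=\left(vA^{-1}+(1-v)B^{-1}\right)^{-1}$. Here $\det(S)^{p}$ denotes the $p$-th power of the (nonnegative real) determinant of the positive semidefinite matrix $S$. *)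

theory Defs
  imports "HOL-Analysis.Analysis"
begin

definition conj_transpose :: "complex^'n^'m \<Rightarrow> complex^'m^'n" where
  "conj_transpose A = (\<chi> i j. cnj (A $ j $ i))"

definition hermitian :: "complex^'n^'n \<Rightarrow> bool" where
  "hermitian A \<longleftrightarrow> conj_transpose A = A"

definition quad_form :: "complex^'n^'n \<Rightarrow> complex^'n \<Rightarrow> complex" where
  "quad_form A x = (\<Sum>i\<in>UNIV. cnj (x $ i) * (A *v x) $ i)"

(* The quadratic form of a Hermitian matrix is real-valued, so Re loses nothing. *)
definition positive_definite :: "complex^'n^'n \<Rightarrow> bool" where
  "positive_definite A \<longleftrightarrow> hermitian A \<and> (\<forall>x. x \<noteq> 0 \<longrightarrow> Re (quad_form A x) > 0)"

definition arith_mean :: "real \<Rightarrow> complex^'n^'n \<Rightarrow> complex^'n^'n \<Rightarrow> complex^'n^'n" where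
  "arith_mean v A B = v *\<^sub>R A + (1 - v) *\<^sub>R B"

definition harm_mean :: "real \<Rightarrow> complex^'n^'n \<Rightarrow> complex^'n^'n \<Rightarrow> complex^'n^'n" where
  "harm_mean v A B = matrix_inv (v *\<^sub>R matrix_inv A + (1 - v) *\<^sub>R matrix_inv B)"

(* Intended for positive semidefinite S: then det S is a nonnegative real embedded in the
   complex numbers, and Re recovers it.  For p > 0 the convention 0 powr p = 0 gives the
   usual power of a vanishing determinant. *)
definition det_power :: "complex^'n^'n \<Rightarrow> real \<Rightarrow> real" where
  "det_power S p = Re (det S) powr p"

end

(* The roots of det (x B + A), as a polynomial in x, are real and negative, because A w = d B w
   forces d = (w* A w) / (w* B w). So det (x B + y A) = det B * prod_i (x + y d_i) with d_i > 0,
   which replaces simultaneous diagonalization. With C_t = t B + (1 - t) A one has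
   A !_t B = B C_t^-1 A and, as (1 - t)(A - B) = C_t - B and t (A - B) = A - C_t,
   A nabla_t B - A !_t B = t (1 - t) (A - B) C_t^-1 (A - B).
   All determinants in the claim are therefore det B times products over i of the corresponding
   scalar expressions in d_i and 1. The scalar differences decrease when divided by t, and the rest
   is Minkowski's inequality for products (from AM-GM) followed by superadditivity of the
   lam-th power. *)
theory Submission
  imports Defs "HOL-Computational_Algebra.Fundamental_Theorem_Algebra"
begin

section \<open>Scalar inequalities: Minkowski for products and superadditivity of powers\<close>

lemma prod_root_add_le:
  fixes f g :: "'a \<Rightarrow> real"
  assumes "finite I" and "I \<noteq> {}"
    and f: "\<And>i. i \<in> I \<Longrightarrow> 0 \<le> f i" and g: "\<And>i. i \<in> I \<Longrightarrow> 0 \<le> g i"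
    and pos: "\<And>i. i \<in> I \<Longrightarrow> 0 < f i + g i"
  shows "(\<Prod>i\<in>I. f i) powr (1 / card I) + (\<Prod>i\<in>I. g i) powr (1 / card I)
    \<le> (\<Prod>i\<in>I. f i + g i) powr (1 / card I)"
proof -
  have S: "0 < (\<Prod>i\<in>I. f i + g i)"
    using pos by (simp add: prod_pos)
  \<comment> \<open>AM-GM for the normalized factors \<open>h i / (f i + g i)\<close>. It is used
    with \<open>h = f\<close> and with \<open>h = g\<close>, where the two arithmetic means add up
    to 1.\<close>
  have *: "(\<Prod>i\<in>I. h i) powr (1 / card I)
      \<le> (\<Prod>i\<in>I. f i + g i) powr (1 / card I) * (\<Sum>i\<in>I. h i / (f i + g i) / card I)"
    if h: "\<And>i. i \<in> I \<Longrightarrow> 0 \<le> h i" for h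
  proof -
    have "(\<Prod>i\<in>I. h i / (f i + g i)) powr (1 / card I) \<le> (\<Sum>i\<in>I. h i / (f i + g i) / card I)"
      by (rule arith_geom_mean) (use assms h in \<open>auto simp: less_imp_le\<close>)
    moreover have "(\<Prod>i\<in>I. h i / (f i + g i)) powr (1 / card I) =
        (\<Prod>i\<in>I. h i) powr (1 / card I) / (\<Prod>i\<in>I. f i + g i) powr (1 / card I)"
      using h S by (simp add: prod_dividef powr_divide prod_nonneg less_imp_le)
    ultimately show ?thesis
      using S by (simp add: divide_le_eq mult.commute)
  qed
  have "(\<Sum>i\<in>I. f i / (f i + g i) / card I) + (\<Sum>i\<in>I. g i / (f i + g i) / card I)
      = (\<Sum>i\<in>I. 1 / card I)"
    unfolding sum.distrib [symmetric]
  proof (rule sum.cong)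
    show "f i / (f i + g i) / card I + g i / (f i + g i) / card I = 1 / card I" if "i \<in> I" for i
      using pos [OF that] by (simp flip: add_divide_distrib)
  qed simp
  also have "\<dots> = 1"
    using assms by simp
  finally have "(\<Prod>i\<in>I. f i + g i) powr (1 / card I) =
      (\<Prod>i\<in>I. f i + g i) powr (1 / card I) * (\<Sum>i\<in>I. f i / (f i + g i) / card I)
      + (\<Prod>i\<in>I. f i + g i) powr (1 / card I) * (\<Sum>i\<in>I. g i / (f i + g i) / card I)"
    by (simp flip: distrib_left)
  then show ?thesis
    using * [of f, OF f] * [of g, OF g] by linarith
qed

text \<open>The ratios \<open>x / (x + y)\<close> and \<open>y / (x + y)\<close> lie between 0 and
  1, so raising them to the power \<open>p\<close> does not increase them, and they sum to
  1.\<close>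

lemma powr_superadditive:
  fixes x y p :: real
  assumes "0 \<le> x" and "0 \<le> y" and "1 \<le> p"
  shows "x powr p + y powr p \<le> (x + y) powr p"
proof (cases "x + y = 0")
  case True
  then show ?thesis
    using assms by (simp add: add_nonneg_eq_0_iff)
next
  case False
  then have pos: "0 < x + y"
    using assms by simp
  have *: "z powr p \<le> (x + y) powr p * (z / (x + y))" if "0 \<le> z" "z \<le> x + y" for z
  proof -
    have "(z / (x + y)) powr p \<le> (z / (x + y)) powr 1"
      by (rule powr_mono') (use that pos assms in auto)
    then show ?thesis
      using that pos by (simp add: powr_divide divide_le_eq mult.commute)
  qed
  have "x / (x + y) + y / (x + y) = 1"
    using pos by (simp flip: add_divide_distrib)
  then have "(x + y) powr p * (x / (x + y)) + (x + y) powr p * (y / (x + y)) = (x + y) powr p"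
    by (metis distrib_left mult.right_neutral)
  with * [of x] * [of y] show ?thesis
    using assms by linarith
qed

text \<open>The exponent is taken in two stages, \<open>1 / card I\<close> and then
  \<open>p\<close>: superadditivity merges the two powers on the left, and Minkowski is applied
  under the monotone \<open>p\<close>-th power.\<close>

lemma prod_powr_add_le:
  fixes f g :: "'a \<Rightarrow> real"
  assumes "finite I" and "I \<noteq> {}"
    and f: "\<And>i. i \<in> I \<Longrightarrow> 0 \<le> f i" and g: "\<And>i. i \<in> I \<Longrightarrow> 0 \<le> g i"
    and pos: "\<And>i. i \<in> I \<Longrightarrow> 0 < f i + g i" and "1 \<le> p"
  shows "(\<Prod>i\<in>I. f i) powr (p / card I) + (\<Prod>i\<in>I. g i) powr (p / card I)
    \<le> (\<Prod>i\<in>I. f i + g i) powr (p / card I)"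
proof -
  have eq: "x powr (p / card I) = (x powr (1 / card I)) powr p" for x :: real
    by (simp add: powr_powr)
  have "(\<Prod>i\<in>I. f i) powr (p / card I) + (\<Prod>i\<in>I. g i) powr (p / card I)
    \<le> ((\<Prod>i\<in>I. f i) powr (1 / card I) + (\<Prod>i\<in>I. g i) powr (1 / card I)) powr p"
    unfolding eq by (rule powr_superadditive) (use \<open>1 \<le> p\<close> in auto)
  also have "\<dots> \<le> (\<Prod>i\<in>I. f i + g i) powr (p / card I)"
    unfolding eq [of "\<Prod>i\<in>I. f i + g i"]
    by (rule powr_mono2) (use prod_root_add_le [OF assms(1-5)] \<open>1 \<le> p\<close> in auto)
  finally show ?thesis .
qed

section \<open>The determinant of a linear pencil as a polynomial\<close>

lemma coeff_prod_degree_le_1: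
  fixes p :: "'a \<Rightarrow> 'b::comm_ring_1 poly"
  assumes "finite S" and "\<And>i. i \<in> S \<Longrightarrow> degree (p i) \<le> 1"
  shows "degree (\<Prod>i\<in>S. p i) \<le> card S \<and> coeff (\<Prod>i\<in>S. p i) (card S) = (\<Prod>i\<in>S. coeff (p i) 1)"
  using assms
proof (induction S rule: finite_induct)
  case empty
  then show ?case by simp
next
  case (insert i S)
  let ?Q = "\<Prod>j\<in>S. p j"
  have IH: "degree ?Q \<le> card S" "coeff ?Q (card S) = (\<Prod>j\<in>S. coeff (p j) 1)"
    using insert by auto
  \<comment> \<open>Constant factors are allowed, so \<open>b\<close> may be 0; hence the
    coefficient is followed at the fixed index \<open>card S\<close> and not as a
    \<open>lead_coeff\<close>.\<close>
  obtain a b where ab: "p i = [:a, b:]"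
  proof
    show "p i = [:coeff (p i) 0, coeff (p i) 1:]"
      using insert.prems [of i]
      by (intro poly_eqI) (auto simp: coeff_pCons coeff_eq_0 split: nat.splits)
  qed
  have "degree (p i * ?Q) \<le> 1 + card S"
    using degree_mult_le [of "p i" ?Q] insert.prems [of i] IH by auto
  moreover have "coeff (p i * ?Q) (Suc (card S)) = b * coeff ?Q (card S)"
    using IH(1) by (simp add: ab coeff_eq_0)
  ultimately show ?case
    using insert.hyps IH by (simp add: ab)
qed

lemma poly_det:
  fixes P :: "'a::comm_ring_1 poly^'n^'n"
  shows "poly (det P) z = det (\<chi> i j. poly (P $ i $ j) z)"
  by (simp add: det_def poly_sum poly_prod)

text \<open>Each summand of the Leibniz expansion is a signed product of \<open>CARD('n)\<close>
  linear entries, whose top coefficient collects the entries of \<open>B\<close> only.\<close>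

lemma det_pencil_poly:
  fixes A B :: "'a::comm_ring_1^'n^'n"
  defines "P \<equiv> \<chi> i j. [:A $ i $ j, B $ i $ j:]"
  shows "degree (det P) \<le> CARD('n)" and "coeff (det P) CARD('n) = det B"
proof -
  have deg: "degree (P $ i $ j) \<le> 1" for i j
    by (simp add: P_def)
  note * = coeff_prod_degree_le_1 [of "UNIV :: 'n set", OF _ deg]
  have s: "of_int k * p = smult (of_int k) p" for k and p :: "'a poly"
    by (simp add: of_int_poly)
  show "degree (det P) \<le> CARD('n)"
    unfolding det_def s
    by (intro degree_sum_le order_trans [OF degree_smult_le]) (use * in auto)
  show "coeff (det P) CARD('n) = det B"
    unfolding det_def s using *
    by (simp add: coeff_sum) (simp add: P_def)
qed

lemma det_scaleR:
  fixes A :: "complex^'n^'n"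
  shows "det (c *\<^sub>R A) = of_real c ^ CARD('n) * det A"
proof -
  have "c *\<^sub>R A = (\<chi> i. of_real c *s A $ i)"
    by (simp add: vec_eq_iff) (simp add: scaleR_conv_of_real)
  then show ?thesis
    using det_rows_mul [of "\<lambda>i. of_real c" "\<lambda>i. A $ i"] by simp
qed

section \<open>Positive definite matrices and the real factorization of the pencil\<close>

lemma quad_form_hermitian_real:
  assumes "hermitian A"
  shows "quad_form A x = of_real (Re (quad_form A x))"
proof -
  have A: "cnj (A $ i $ j) = A $ j $ i" for i j
    using assms by (metis (no_types, lifting) conj_transpose_def hermitian_def vec_lambda_beta)
  have "cnj (quad_form A x) = (\<Sum>i\<in>UNIV. \<Sum>j\<in>UNIV. x $ i * (A $ j $ i * cnj (x $ j)))"
    by (simp add: quad_form_def matrix_vector_mult_def sum_distrib_left A)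
  also have "\<dots> = (\<Sum>j\<in>UNIV. \<Sum>i\<in>UNIV. x $ i * (A $ j $ i * cnj (x $ j)))"
    by (rule sum.swap)
  also have "\<dots> = quad_form A x"
    by (simp add: quad_form_def matrix_vector_mult_def sum_distrib_left mult_ac)
  finally show ?thesis
    by (metis Reals_cnj_iff of_real_Re)
qed

lemma det_0_kernel:
  fixes A :: "'a::field^'n^'n"
  assumes "det A = 0"
  obtains x where "x \<noteq> 0" and "A *v x = 0"
  using assms matrix_left_invertible_ker [of A]
  by (metis invertible_det_nz invertible_left_inverse)

lemma det_positive_definite_nonzero:
  assumes "positive_definite A"
  shows "det A \<noteq> 0"
proof
  assume "det A = 0"
  then obtain x where "x \<noteq> 0" "A *v x = 0"
    by (rule det_0_kernel)
  then show False
    using assms by (force simp: positive_definite_def quad_form_def)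
qed

text \<open>The \<open>d i\<close> are the negated roots of \<open>det (A + z B)\<close> in
  \<open>z\<close>, that is, the eigenvalues of \<open>B^-1 A\<close> with multiplicity. Homogeneity
  of the determinant passes from \<open>z\<close> to the pair \<open>x\<close>,
  \<open>y\<close>.\<close>

lemma det_pencil:
  fixes A B :: "complex^'n^'n"
  assumes A: "positive_definite A" and B: "positive_definite B"
  obtains d :: "nat \<Rightarrow> real" where "\<And>i. i < CARD('n) \<Longrightarrow> 0 < d i"
    and "\<And>x y. det (x *\<^sub>R B + y *\<^sub>R A) = det B * of_real (\<Prod>i<CARD('n). x + y * d i)"
proof -
  define P :: "complex poly^'n^'n" where "P = (\<chi> i j. [:A $ i $ j, B $ i $ j:])"
  have eval: "poly (det P) z = det (\<chi> i j. A $ i $ j + z * B $ i $ j)" for z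
    by (simp add: poly_det P_def)
  have "coeff (det P) CARD('n) = det B" "degree (det P) \<le> CARD('n)"
    using det_pencil_poly [of A B] by (simp_all add: P_def)
  moreover have "det B \<noteq> 0"
    using B by (rule det_positive_definite_nonzero)
  ultimately have deg: "degree (det P) = CARD('n)" "lead_coeff (det P) = det B" "det P \<noteq> 0"
    using le_degree [of "det P" "CARD('n)"] by force+
  obtain M where M: "size M = CARD('n)" "det P = smult (det B) (\<Prod>z\<in>#M. [:-z, 1:])"
    using alg_closed_imp_factorization [OF deg(3)] deg by auto
  obtain zs where zs: "mset zs = M"
    using ex_mset by blast
  have len: "length zs = CARD('n)"
    using M zs by auto
  have fact: "poly (det P) z = det B * (\<Prod>i<CARD('n). z - zs ! i)" for z
  proof -
    have "poly (det P) z = det B * prod_list (map (\<lambda>a. z - a) zs)"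
      by (simp add: M(2) poly_prod_mset flip: zs prod_mset_prod_list)
    then show ?thesis
      by (simp add: prod.list_conv_set_nth len lessThan_atLeast0)
  qed
  have root: "zs ! i = of_real (Re (zs ! i)) \<and> Re (zs ! i) < 0" if "i < CARD('n)" for i
  proof -
    let ?z = "zs ! i"
    have "poly (det P) ?z = 0"
      using that by (auto simp: fact)
    \<comment> \<open>Pairing this kernel vector with itself gives
      \<open>quad_form A x = - ?z * quad_form B x\<close>; both forms are positive reals, so
      \<open>?z\<close> is a negative real.\<close>
    then obtain x where x: "x \<noteq> 0" "(\<chi> i j. A $ i $ j + ?z * B $ i $ j) *v x = 0"
      unfolding eval by (rule det_0_kernel)
    have "(A *v x) $ k = - ?z * (B *v x) $ k" for k
    proof -
      have "(A *v x) $ k + ?z * (B *v x) $ k = ((\<chi> i j. A $ i $ j + ?z * B $ i $ j) *v x) $ k"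
        by (simp add: matrix_vector_mult_def sum_distrib_left sum.distrib algebra_simps)
      then show ?thesis
        using x(2) by (simp add: add_eq_0_iff)
    qed
    then have "quad_form A x = - ?z * quad_form B x"
      by (simp add: quad_form_def sum_distrib_left sum_negf mult_ac)
    moreover obtain a b where "quad_form A x = of_real a" "a > 0" "quad_form B x = of_real b" "b > 0"
      using A B x(1) quad_form_hermitian_real unfolding positive_definite_def by metis
    ultimately have "?z = of_real (- a / b)" "- a / b < 0"
      by (auto simp: field_simps)
    then show ?thesis
      by (metis Re_complex_of_real)
  qed
  show thesis
  proof
    show "0 < - Re (zs ! i)" if "i < CARD('n)" for i
      using root [OF that] by simp
    show "det (x *\<^sub>R B + y *\<^sub>R A) = det B * of_real (\<Prod>i<CARD('n). x + y * (- Re (zs ! i)))" for x y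
    \<comment> \<open>For nonzero \<open>y\<close> the factorization is evaluated at
      \<open>z = x / y\<close>; the remaining case is plain scaling of \<open>B\<close>.\<close>
    proof (cases "y = 0")
      case True
      then show ?thesis
        by (simp add: det_scaleR)
    next
      case False
      have "x *\<^sub>R B + y *\<^sub>R A = y *\<^sub>R (\<chi> i j. A $ i $ j + of_real (x / y) * B $ i $ j)"
        using False by (simp add: vec_eq_iff) (simp add: scaleR_conv_of_real field_simps)
      then have "det (x *\<^sub>R B + y *\<^sub>R A)
          = of_real y ^ CARD('n) * (det B * (\<Prod>i<CARD('n). of_real (x / y) - zs ! i))"
        by (simp only: det_scaleR fact flip: eval)
      also have "\<dots> = det B * (\<Prod>i<CARD('n). of_real y * (of_real (x / y) - zs ! i))"
        by (simp add: prod.distrib)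
      also have "(\<Prod>i<CARD('n). of_real y * (of_real (x / y) - zs ! i))
          = (\<Prod>i<CARD('n). of_real (x + y * (- Re (zs ! i))))"
      proof (rule prod.cong)
        show "of_real y * (of_real (x / y) - zs ! i) = of_real (x + y * (- Re (zs ! i)))"
          if "i \<in> {..<CARD('n)}" for i
        proof -
          have "zs ! i = of_real (Re (zs ! i))"
            using root that by simp
          then have "of_real y * (of_real (x / y) - zs ! i) = of_real y * (of_real (x / y) - of_real (Re (zs ! i)))"
            by simp
          also have "\<dots> = of_real (y * (x / y - Re (zs ! i)))"
            by simp
          also have "y * (x / y - Re (zs ! i)) = x + y * (- Re (zs ! i))"
            using False by (simp add: right_diff_distrib)
          finally show ?thesis .
        qed
      qed simp
      finally show ?thesis
        by simp
    qed
  qed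
qed

lemma positive_definite_mat_1: "positive_definite (mat 1 :: complex^'n^'n)"
proof -
  have "0 < Re (\<Sum>i\<in>UNIV. cnj (x $ i) * x $ i)" if x: "x \<noteq> 0" for x :: "complex^'n"
  proof -
    obtain k where "x $ k \<noteq> 0"
      using x by (auto simp: vec_eq_iff)
    then have "0 < (\<Sum>i\<in>UNIV. (cmod (x $ i))\<^sup>2)"
      by (intro sum_pos2 [of _ k]) auto
    also have "\<dots> = Re (\<Sum>i\<in>UNIV. cnj (x $ i) * x $ i)"
      by (simp add: cmod_power2) (simp add: power2_eq_square)
    finally show ?thesis .
  qed
  moreover have "hermitian (mat 1 :: complex^'n^'n)"
    by (simp add: hermitian_def conj_transpose_def mat_def vec_eq_iff)
  ultimately show ?thesis
    by (simp add: positive_definite_def quad_form_def)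
qed

text \<open>The pencil with \<open>mat 1\<close> in the role of \<open>B\<close>, taken at
  \<open>x = 0\<close> and \<open>y = 1\<close>, writes \<open>det A\<close> as the product of the
  positive \<open>d i\<close>.\<close>

lemma det_positive_definite:
  fixes A :: "complex^'n^'n"
  assumes "positive_definite A"
  obtains k where "0 < k" and "det A = of_real k"
proof -
  obtain d :: "nat \<Rightarrow> real" where d: "\<And>i. i < CARD('n) \<Longrightarrow> 0 < d i"
    "\<And>x y. det (x *\<^sub>R mat 1 + y *\<^sub>R A) = det (mat 1 :: complex^'n^'n) * of_real (\<Prod>i<CARD('n). x + y * d i)"
    using det_pencil [OF assms positive_definite_mat_1] by blast
  show thesis
  proof
    show "0 < (\<Prod>i<CARD('n). d i)"
      using d(1) by (intro prod_pos) auto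
    show "det A = of_real (\<Prod>i<CARD('n). d i)"
      using d(2) [of 0 1] by simp
  qed
qed

section \<open>Matrix inverses and product formulas for the means\<close>

lemma matrix_inv_mult:
  fixes A :: "'a::field^'n^'n"
  assumes "det A \<noteq> 0"
  shows "A ** matrix_inv A = mat 1" and "matrix_inv A ** A = mat 1"
proof -
  have "\<exists>A'. A ** A' = mat 1 \<and> A' ** A = mat 1"
    using assms by (simp add: flip: invertible_det_nz invertible_def)
  then have "A ** matrix_inv A = mat 1 \<and> matrix_inv A ** A = mat 1"
    unfolding matrix_inv_def by (rule someI_ex)
  then show "A ** matrix_inv A = mat 1" and "matrix_inv A ** A = mat 1"
    by auto
qed

text \<open>A right inverse suffices: determinants multiply, so \<open>det A\<close> cannot
  vanish.\<close>

lemma matrix_inv_eqI: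
  fixes A :: "'a::field^'n^'n"
  assumes "A ** B = mat 1"
  shows "matrix_inv A = B"
proof -
  have "det A \<noteq> 0"
    using arg_cong [OF assms, of det] by (auto simp: det_mul)
  then show ?thesis
    by (metis assms matrix_inv_mult(2) matrix_mul_assoc matrix_mul_lid matrix_mul_rid)
qed

lemma matrix_mul_diff_distribs:
  fixes A B C :: "'a::ring_1^'n^'n"
  shows "(A - B) ** C = A ** C - B ** C" and "C ** (A - B) = C ** A - C ** B"
  by (simp_all add: matrix_matrix_mult_def vec_eq_iff sum_subtractf algebra_simps)

lemma matrix_add_rdistrib:
  fixes A B C :: "'a::ring_1^'n^'n"
  shows "(A + B) ** C = A ** C + B ** C"
  by (simp add: matrix_matrix_mult_def vec_eq_iff sum.distrib algebra_simps)

text \<open>Multiplying the weighted sum of inverses by \<open>A\<close> on the left and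
  \<open>B\<close> on the right gives \<open>v B + (1 - v) A\<close>, the arithmetic mean with the
  matrices exchanged. The product form makes the determinant computable from the pencil.\<close>

lemma harm_mean_eq:
  fixes A B :: "complex^'n^'n"
  assumes A: "det A \<noteq> 0" and B: "det B \<noteq> 0" and C: "det (arith_mean v B A) \<noteq> 0"
  shows "harm_mean v A B = B ** matrix_inv (arith_mean v B A) ** A"
  unfolding harm_mean_def
proof (rule matrix_inv_eqI)
  let ?C = "arith_mean v B A" and ?S = "v *\<^sub>R matrix_inv A + (1 - v) *\<^sub>R matrix_inv B"
  have "A ** (?S ** B) = ?C"
    using matrix_inv_mult [OF A] matrix_inv_mult [OF B]
    by (simp add: arith_mean_def matrix_add_ldistrib matrix_add_rdistrib matrix_mul_assoc
        matrix_scalar_ac flip: scalar_matrix_assoc)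
  then have "?S ** B = matrix_inv A ** ?C"
    by (metis A matrix_inv_mult(2) matrix_mul_assoc matrix_mul_lid)
  then show "?S ** (B ** matrix_inv ?C ** A) = mat 1"
    by (metis A C matrix_inv_mult(1) matrix_inv_mult(2) matrix_mul_assoc matrix_mul_rid)
qed

lemma arith_mean_minus_harm_mean:
  fixes A B :: "complex^'n^'n"
  assumes A: "det A \<noteq> 0" and B: "det B \<noteq> 0" and C: "det (arith_mean v B A) \<noteq> 0"
  shows "arith_mean v A B - harm_mean v A B
    = (v * (1 - v)) *\<^sub>R ((A - B) ** matrix_inv (arith_mean v B A) ** (A - B))"
proof -
  let ?C = "arith_mean v B A"
  have 1: "(1 - v) *\<^sub>R (A - B) = ?C - B" and 2: "v *\<^sub>R (A - B) = A - ?C"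
    and 3: "arith_mean v A B = A + B - ?C"
    by (simp_all add: arith_mean_def algebra_simps)
  have "(v * (1 - v)) *\<^sub>R ((A - B) ** matrix_inv ?C ** (A - B))
      = ((1 - v) *\<^sub>R (A - B)) ** matrix_inv ?C ** (v *\<^sub>R (A - B))"
    by (simp add: matrix_scalar_ac flip: scalar_matrix_assoc)
  also have "\<dots> = (?C - B) ** matrix_inv ?C ** (A - ?C)"
    by (simp only: 1 2)
  \<comment> \<open>On expanding, \<open>?C\<close> cancels against its inverse in every term but
    the last.\<close>
  also have "\<dots> = A + B - ?C - B ** matrix_inv ?C ** A"
    using matrix_inv_mult [OF C] by (simp add: matrix_mul_diff_distribs flip: matrix_mul_assoc)
  finally show ?thesis
    by (simp add: harm_mean_eq [OF assms] 3)
qed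

section \<open>Reduction to scalars and the final inequality\<close>

theorem theorem5p4:
  fixes A B :: "complex^'n^'n" and v \<tau> lam :: real
  assumes "positive_definite A" and "positive_definite B"
    and "0 < v" and "v \<le> \<tau>" and "\<tau> < 1" and "1 \<le> lam"
  shows "(v / \<tau>) powr lam * det_power (arith_mean \<tau> A B - harm_mean \<tau> A B) (lam / real CARD('n))
    \<le> det_power (arith_mean v A B) (lam / real CARD('n))
      - det_power (harm_mean v A B) (lam / real CARD('n))"
proof -
  let ?n = "CARD('n)"
  obtain d :: "nat \<Rightarrow> real" where d: "\<And>i. i < ?n \<Longrightarrow> 0 < d i"
    and pencil: "\<And>x y. det (x *\<^sub>R B + y *\<^sub>R A) = det B * of_real (\<Prod>i<?n. x + y * d i)"
    using det_pencil [OF assms(1,2)] by blast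
  obtain k where k: "0 < k" "det B = of_real k"
    using det_positive_definite [OF assms(2)] .
  have A0: "det A \<noteq> 0" and B0: "det B \<noteq> 0"
    using assms det_positive_definite_nonzero by auto
  have detA: "det A = of_real (k * (\<Prod>i<?n. d i))"
    using pencil [of 0 1] k by simp
  \<comment> \<open>\<open>A - B\<close> may be indefinite; the factors \<open>d i - 1\<close> of
    either sign enter only squared.\<close>
  have detAB: "det (A - B) = of_real (k * (\<Prod>i<?n. d i - 1))"
    using pencil [of "-1" 1] k by simp

  \<comment> \<open>For the scalars \<open>d i\<close> and 1, \<open>a\<close> is the arithmetic
    mean, \<open>c\<close> the one with exchanged arguments, \<open>h\<close> the harmonic mean and
    \<open>f\<close> the difference \<open>a - h\<close>.\<close>
  define a where "a t i = t * d i + (1 - t)" for t i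
  define c where "c t i = t + (1 - t) * d i" for t i
  define h where "h t i = d i / c t i" for t i
  define f where "f t i = t * (1 - t) * (d i - 1)\<^sup>2 / c t i" for t i
  have c_pos: "0 < c t i" if "0 < t" "t < 1" "i < ?n" for t i
    using that d by (simp add: c_def add_pos_pos)
  have a_eq: "a t i = f t i + h t i" if "0 < t" "t < 1" "i < ?n" for t i
  proof -
    have "a t i * c t i = t * (1 - t) * (d i - 1)\<^sup>2 + d i"
      by (simp add: a_def c_def power2_eq_square algebra_simps)
    then show ?thesis
      using c_pos [OF that] by (simp add: f_def h_def field_simps)
  qed
  have det_arith: "det (arith_mean t A B) = of_real (k * (\<Prod>i<?n. a t i))" for t
    using pencil [of "1 - t" t] k by (simp add: arith_mean_def a_def add.commute)
  have det_C: "det (arith_mean t B A) = of_real (k * (\<Prod>i<?n. c t i))" for t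
    using pencil [of t "1 - t"] k by (simp add: arith_mean_def c_def)
  have C0: "det (arith_mean t B A) \<noteq> 0" if "0 < t" "t < 1" for t
    unfolding det_C of_real_eq_0_iff using k c_pos [OF that] by force
  have det_C_inv: "det (matrix_inv (arith_mean t B A)) = of_real (1 / (k * (\<Prod>i<?n. c t i)))"
    if "0 < t" "t < 1" for t
  proof -
    have "det (arith_mean t B A) * det (matrix_inv (arith_mean t B A)) = 1"
      using matrix_inv_mult(1) [OF C0 [OF that]] by (metis det_I det_mul)
    then show ?thesis
      using C0 [OF that] unfolding det_C by (simp add: field_simps)
  qed
  have det_harm: "det (harm_mean t A B) = of_real (k * (\<Prod>i<?n. h t i))" if "0 < t" "t < 1" for t
    using k det_C_inv [OF that]
    by (simp add: harm_mean_eq [OF A0 B0 C0 [OF that]] det_mul detA h_def prod_dividef)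
  have det_diff: "det (arith_mean t A B - harm_mean t A B) = of_real (k * (\<Prod>i<?n. f t i))"
    if "0 < t" "t < 1" for t
  proof -
    \<comment> \<open>Two factors \<open>det (A - B)\<close> and one inverse contribute
      \<open>k * k / k\<close>, so a single \<open>k\<close> remains, as in \<open>det_arith\<close>
      and \<open>det_harm\<close>.\<close>
    have "(\<Prod>i<?n. f t i) = (t * (1 - t)) ^ ?n * (\<Prod>i<?n. d i - 1)\<^sup>2 / (\<Prod>i<?n. c t i)"
      by (simp add: f_def prod_dividef prod.distrib prod_power_distrib)
    moreover have "k \<noteq> 0"
      using k by simp
    ultimately show ?thesis
      unfolding arith_mean_minus_harm_mean [OF A0 B0 C0 [OF that]] det_scaleR det_mul
        det_C_inv [OF that] detAB
      by (simp add: power2_eq_square)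
  qed

  have v: "0 < v" "v < 1" and \<tau>: "0 < \<tau>" "\<tau> < 1"
    using assms by auto
  have f_nonneg: "0 \<le> f t i" if "0 < t" "t < 1" "i < ?n" for t i
    using that c_pos [OF that] by (simp add: f_def)
  have h_pos: "0 < h t i" if "0 < t" "t < 1" "i < ?n" for t i
    using d that c_pos [OF that] by (simp add: h_def)
  \<comment> \<open>\<open>f t i / t\<close> is \<open>(d i - 1)^2\<close> divided by
    \<open>c t i / (1 - t) = t / (1 - t) + d i\<close>, which grows with \<open>t\<close>. After
    cross-multiplication the terms with \<open>d i\<close> agree and \<open>v \<le> \<tau>\<close>
    is left.\<close>
  have f_mono: "v / \<tau> * f \<tau> i \<le> f v i" if i: "i < ?n" for i
  proof -
    have "(1 - \<tau>) * c v i \<le> (1 - v) * c \<tau> i"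
      using \<open>v \<le> \<tau>\<close> by (simp add: c_def algebra_simps)
    then have "(1 - \<tau>) / c \<tau> i \<le> (1 - v) / c v i"
      using c_pos [OF v i] c_pos [OF \<tau> i] by (simp add: field_simps)
    then have "v * (d i - 1)\<^sup>2 * ((1 - \<tau>) / c \<tau> i) \<le> v * (d i - 1)\<^sup>2 * ((1 - v) / c v i)"
      using v by (intro mult_left_mono) auto
    moreover have "v / \<tau> * f \<tau> i = v * (d i - 1)\<^sup>2 * ((1 - \<tau>) / c \<tau> i)"
      using \<tau> by (simp add: f_def)
    moreover have "f v i = v * (d i - 1)\<^sup>2 * ((1 - v) / c v i)"
      by (simp add: f_def)
    ultimately show ?thesis
      by simp
  qed
  let ?p = "lam / ?n"
  have p: "0 \<le> ?p"
    using assms by simp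
  \<comment> \<open>As an \<open>?n\<close>-th power inside \<open>powr ?p\<close>, the prefactor
    gives one \<open>v / \<tau>\<close> to each \<open>f \<tau> i\<close>.\<close>
  have "(v / \<tau>) powr lam = ((v / \<tau>) ^ ?n) powr ?p"
    using v \<tau> by (simp add: powr_powr flip: powr_realpow)
  then have "(v / \<tau>) powr lam * (\<Prod>i<?n. f \<tau> i) powr ?p = (\<Prod>i<?n. v / \<tau> * f \<tau> i) powr ?p"
    using v \<tau> f_nonneg [OF \<tau>]
    by (simp only: prod.distrib) (simp add: powr_mult prod_nonneg del: power_divide times_divide_eq_left)
  also have "\<dots> \<le> (\<Prod>i<?n. f v i) powr ?p"
    using p v \<tau> f_nonneg [OF \<tau>] f_mono
    by (intro powr_mono2 prod_mono prod_nonneg) auto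
  \<comment> \<open>Positivity of \<open>h v i\<close> keeps the sums positive even where
    \<open>d i = 1\<close> and \<open>f v i\<close> vanishes.\<close>
  also have "\<dots> \<le> (\<Prod>i<?n. f v i + h v i) powr ?p - (\<Prod>i<?n. h v i) powr ?p"
    using prod_powr_add_le [of "{..<?n}" "f v" "h v" lam] f_nonneg [OF v] h_pos [OF v] assms
    by (simp add: less_imp_le add_nonneg_pos lessThan_empty_iff)
  also have "(\<Prod>i<?n. f v i + h v i) = (\<Prod>i<?n. a v i)"
    using a_eq [OF v] by simp
  \<comment> \<open>The common factor \<open>k\<close>, the value of \<open>det B\<close>, is put
    back: each determinant in the claim is \<open>k\<close> times one of these products.\<close>
  finally have "k powr ?p * ((v / \<tau>) powr lam * (\<Prod>i<?n. f \<tau> i) powr ?p)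
      \<le> k powr ?p * ((\<Prod>i<?n. a v i) powr ?p - (\<Prod>i<?n. h v i) powr ?p)"
    by (intro mult_left_mono) auto
  moreover have "0 \<le> (\<Prod>i<?n. f \<tau> i)" "0 \<le> (\<Prod>i<?n. a v i)" "0 \<le> (\<Prod>i<?n. h v i)"
    using f_nonneg [OF \<tau>] f_nonneg [OF v] h_pos [OF v] a_eq [OF v]
    by (auto intro!: prod_nonneg simp: less_imp_le)
  ultimately show ?thesis
    using k by (simp add: det_power_def det_arith det_harm [OF v] det_diff [OF \<tau>] powr_mult
        right_diff_distrib mult_ac del: of_real_mult of_real_prod)
qed

end
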